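(* Consider the univariate nonparametric regression model $U_j=h(Z_j)+\varepsilon_j$, $j=1,\dots,n$, where $Z_1,\dots,Z_n$ are i.i.d. with design density $f_Z$ and the $\varepsilon_j$ are i.i.d. standard Gaussian and independent of the $Z_j$. Let $\bar\rho>1$, $0<\rho<1$ and $\tilde\rho>0$. Let $\mathcal{F}=\mathcal{F}(\rho,\bar\rho)$ be the class of all measurable probability densities on $[0,1]$ which are bounded from above by $\bar\rho$ and from below by $\rho$, and let $\mathcal{H}=\mathcal{H}(\tilde\rho)$ be the class of all measurable functions $h$ on $[0,1]$ bounded by $\tilde\rho$ (i.e. $|h|\le\tilde\rho$). Then $$\liminf_{n\to\infty}\,n^{1/2}\cdot\sup_{f_Z\in\mathcal{F},\,h\in\mathcal{H}}\mathbb{E}_{f_Z,h}\Big|\hat H_n-\int_{1/4}^{3/4}h(x)\,dx\Big|^2>0$$ for any sequence of estimators $\hat H_n$ based on the data $(U_j,Z_j)$, $j=1,\dots,n$.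
   Context: $\mathbb{E}_{f_Z,h}$ denotes expectation when the design density is $f_Z$ and the regression function is $h$. An estimator based on the data is a real-valued measurable function of $(U_1,Z_1),\dots,(U_n,Z_n)$ which does not depend on the unknown $f_Z$ and $h$. *)

theory Defs
  imports "HOL-Probability.Probability"
begin

text \<open>
  Functions on \<open>[0,1]\<close> are represented by functions \<open>real \<Rightarrow> real\<close> of which only the values
  on \<open>{0..1}\<close> matter: measurability, bounds, densities and integrals are all relative to
  \<open>{0..1}\<close>. Measurable means Borel measurable.
\<close>

definition density_class :: "real \<Rightarrow> real \<Rightarrow> (real \<Rightarrow> real) set" where
  "density_class \<rho> \<rho>bar =
     {f. f \<in> borel_measurable (restrict_space borel {0..1}) \<and>
         (\<forall>x\<in>{0..1}. \<rho> \<le> f x \<and> f x \<le> \<rho>bar) \<and>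
         (\<integral>\<^sup>+x\<in>{0..1}. ennreal (f x) \<partial>lborel) = 1}"

definition regression_class :: "real \<Rightarrow> (real \<Rightarrow> real) set" where
  "regression_class \<rho>til =
     {h. h \<in> borel_measurable (restrict_space borel {0..1}) \<and> (\<forall>x\<in>{0..1}. \<bar>h x\<bar> \<le> \<rho>til)}"

definition design_measure :: "(real \<Rightarrow> real) \<Rightarrow> real measure" where
  "design_measure f = density (restrict_space lborel {0..1}) (\<lambda>x. ennreal (f x))"

definition noise_measure :: "real measure" where
  "noise_measure = density lborel (\<lambda>x. ennreal (std_normal_density x))"

text \<open>
  Canonical probability space of the model: \<open>\<omega> j = (Z\<^sub>j, \<epsilon>\<^sub>j)\<close> for \<open>j \<in> {1..n}\<close>,
  all \<open>2n\<close> variables being independent.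
\<close>

definition model_space :: "nat \<Rightarrow> (real \<Rightarrow> real) \<Rightarrow> (nat \<Rightarrow> real \<times> real) measure" where
  "model_space n f = (\<Pi>\<^sub>M j\<in>{1..n}. design_measure f \<Otimes>\<^sub>M noise_measure)"

text \<open>The observations \<open>(U\<^sub>j, Z\<^sub>j)\<close>, where \<open>U\<^sub>j = h Z\<^sub>j + \<epsilon>\<^sub>j\<close>.\<close>

definition sample :: "nat \<Rightarrow> (real \<Rightarrow> real) \<Rightarrow> (nat \<Rightarrow> real \<times> real) \<Rightarrow> (nat \<Rightarrow> real \<times> real)" where
  "sample n h \<omega> = (\<lambda>j\<in>{1..n}. (h (fst (\<omega> j)) + snd (\<omega> j), fst (\<omega> j)))"

definition estimator :: "nat \<Rightarrow> ((nat \<Rightarrow> real \<times> real) \<Rightarrow> real) \<Rightarrow> bool" where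
  "estimator n T \<longleftrightarrow> T \<in> borel_measurable (\<Pi>\<^sub>M j\<in>{1..n}. borel \<Otimes>\<^sub>M borel)"

text \<open>The mean squared error, as an extended nonnegative number since it may be infinite.\<close>

definition mse ::
  "nat \<Rightarrow> (real \<Rightarrow> real) \<Rightarrow> (real \<Rightarrow> real) \<Rightarrow> ((nat \<Rightarrow> real \<times> real) \<Rightarrow> real) \<Rightarrow> real \<Rightarrow> ennreal" where
  "mse n f h T \<theta> = (\<integral>\<^sup>+\<omega>. ennreal (\<bar>T (sample n h \<omega>) - \<theta>\<bar>\<^sup>2) \<partial>model_space n f)"

lemma sets_design_measure: "sets (design_measure f) = sets (restrict_space borel {0..1})"
  by (simp add: design_measure_def sets_restrict_space)

lemma prob_space_design_measure:
  assumes "f \<in> density_class \<rho> \<rho>bar"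
  shows "prob_space (design_measure f)"
proof -
  have m: "f \<in> borel_measurable (restrict_space lborel {0..1})"
    using assms by (simp add: density_class_def cong: measurable_cong_sets sets_restrict_space_cong)
  have "emeasure (design_measure f) (space (design_measure f)) =
      (\<integral>\<^sup>+x. ennreal (f x) * indicator (space (restrict_space lborel {0..1})) x
         \<partial>restrict_space lborel {0..1})"
    unfolding design_measure_def space_density
    by (intro emeasure_density sets.top measurable_compose[OF m measurable_ennreal])
  also have "\<dots> = (\<integral>\<^sup>+x. ennreal (f x) \<partial>restrict_space lborel {0..1})"
    by (intro nn_integral_cong) simp
  also have "\<dots> = (\<integral>\<^sup>+x\<in>{0..1}. ennreal (f x) \<partial>lborel)"
    by (simp add: nn_integral_restrict_space)
  also have "\<dots> = 1"
    using assms by (simp add: density_class_def)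
  finally show ?thesis
    by (rule prob_spaceI)
qed

lemma prob_space_noise_measure: "prob_space noise_measure"
  unfolding noise_measure_def by (rule prob_space_normal_density) simp

lemma prob_space_model_space:
  assumes "f \<in> density_class \<rho> \<rho>bar"
  shows "prob_space (model_space n f)"
  unfolding model_space_def
  by (intro prob_space_PiM prob_space_pair prob_space_design_measure[OF assms]
      prob_space_noise_measure)

lemma measurable_sample:
  assumes "h \<in> regression_class \<rho>til"
  shows "sample n h \<in> model_space n f \<rightarrow>\<^sub>M (\<Pi>\<^sub>M j\<in>{1..n}. borel \<Otimes>\<^sub>M borel)"
proof -
  have h: "h \<in> borel_measurable (design_measure f)"
    using assms by (simp add: regression_class_def cong: measurable_cong_sets[OF sets_design_measure refl])
  have i: "(\<lambda>x. x) \<in> borel_measurable (design_measure f)"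
    by (subst measurable_cong_sets[OF sets_design_measure refl]) (auto intro: measurable_restrict_space1)
  have s: "snd \<in> borel_measurable (design_measure f \<Otimes>\<^sub>M noise_measure)"
    using measurable_snd[of "design_measure f" noise_measure]
    by (simp add: noise_measure_def cong: measurable_cong_sets)
  have p: "(\<lambda>p. (h (fst p) + snd p, fst p)) \<in>
      design_measure f \<Otimes>\<^sub>M noise_measure \<rightarrow>\<^sub>M borel \<Otimes>\<^sub>M borel"
    by (intro measurable_Pair borel_measurable_add s
        measurable_compose[OF measurable_fst h] measurable_compose[OF measurable_fst i])
  show ?thesis
    unfolding sample_def model_space_def
    by (intro measurable_restrict measurable_compose[OF _ p] measurable_component_singleton)
qed

end

theory Submission
  imports Defs "HOL-Number_Theory.Cong" "HOL-Real_Asymp.Real_Asymp"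
begin

text \<open>
  The mean squared error does not even tend to zero: its supremum over the two classes is bounded
  below by a positive constant that depends neither on \<open>n\<close> (for \<open>n \<ge> 1\<close>) nor on the estimator.
  The square root of \<open>n\<close> in front of it is at least one, so it does no harm.

  The reason is that arbitrarily rough densities and regression functions can be confounded. Fix an
  integer \<open>N\<close>, cut the unit interval into \<open>M\<close> blocks and each block into \<open>2N\<close>
  cells. For a number \<open>k\<close> of plus cells, consider the pattern in which the regression function is
  \<open>b\<close> on \<open>k\<close> cells and \<open>- b\<close> on the others, and in which the design
  density gives the plus cells of a block the same total mass as the minus cells: it is
  \<open>N / k\<close> on the former and \<open>N / (2N - k)\<close> on the latter. Rotate the pattern
  cyclically in each block, with shifts chosen independently and uniformly for the blocks. A single
  observation then has the same law for every \<open>k\<close>: its design point is uniform, and given the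
  design point the regression value is \<open>b\<close> or \<open>- b\<close> with probability one half each. The
  same holds for \<open>n\<close> observations as long as no two of them fall into the same block; if \<open>M\<close> is of
  order \<open>n\<^sup>2\<close>, this happens with probability at least one half. But the integral of the
  regression function is \<open>b (k - N) / (2N)\<close> whatever the shifts are, so it differs between
  \<open>k = N\<close> and \<open>k = N + 1\<close>. No estimator can do well in both cases. The bounds on the
  design density hold for both values of \<open>k\<close> once \<open>N\<close> is large.

  The equality of the two mixtures of joint densities is \<open>sum_obs_density_over_shifts\<close>, the
  probability bound is \<open>distinct_blocks_likely\<close>, and \<open>two_mixtures_lower_bound\<close> turns
  them into a bound for the risk.
\<close>

section \<open>Sums over shifts\<close>

lemma sum_cyclic_shift:
  fixes g :: "nat \<Rightarrow> 'a::comm_monoid_add"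
  assumes "K > 0"
  shows "(\<Sum>i<K. g ((i + s) mod K)) = (\<Sum>i<K. g i)"
proof (rule sum.reindex_bij_betw)
  have "inj_on (\<lambda>i. (i + s) mod K) {..<K}"
  proof (rule inj_onI)
    fix i j assume ij: "i \<in> {..<K}" "j \<in> {..<K}" and "(i + s) mod K = (j + s) mod K"
    then have "[i = j] (mod K)"
      by (simp add: cong_add_rcancel_nat flip: cong_def)
    with ij show "i = j"
      by (simp add: cong_less_modulus_unique_nat)
  qed
  moreover have "(\<lambda>i. (i + s) mod K) ` {..<K} \<subseteq> {..<K}"
    using assms by auto
  ultimately show "bij_betw (\<lambda>i. (i + s) mod K) {..<K} {..<K}"
    by (simp add: bij_betw_def endo_inj_surj)
qed

text \<open>
  Averaging over independent shifts, one for each block: if the points \<open>j\<close> lie in different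
  blocks \<open>\<beta> j\<close>, the factors depend on different coordinates of \<open>s\<close> and the
  average factorises. The blocks without a point contribute a constant.
\<close>

lemma sum_PiE_prod_at_distinct_points:
  fixes F :: "'j \<Rightarrow> 'k \<Rightarrow> 'c::comm_semiring_1" and \<beta> :: "'j \<Rightarrow> 'b"
  assumes "finite B" "finite S" "inj_on \<beta> J" "\<beta> ` J \<subseteq> B"
  shows "(\<Sum>s\<in>B \<rightarrow>\<^sub>E S. \<Prod>j\<in>J. F j (s (\<beta> j))) =
         of_nat (card S) ^ card (B - \<beta> ` J) * (\<Prod>j\<in>J. \<Sum>k\<in>S. F j k)"
proof -
  \<comment> \<open>Turn the product over points into one over all blocks, with factor \<open>1\<close> at empty blocks.\<close>
  define G where "G b k = (if b \<in> \<beta> ` J then F (inv_into J \<beta> b) k else 1)" for b k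
  have G: "G (\<beta> j) k = F j k" if "j \<in> J" for j k
    using that assms(3) by (simp add: G_def)
  have split: "(\<Prod>b\<in>B. u b) = (\<Prod>b\<in>B - \<beta> ` J. u b) * (\<Prod>j\<in>J. u (\<beta> j))" for u :: "'b \<Rightarrow> 'c"
    using prod.subset_diff[OF assms(4,1), of u] by (simp add: prod.reindex[OF assms(3)])
  have "(\<Prod>j\<in>J. F j (s (\<beta> j))) = (\<Prod>b\<in>B. G b (s b))" for s
  proof -
    have "(\<Prod>b\<in>B - \<beta> ` J. G b (s b)) = 1"
      by (rule prod.neutral) (simp add: G_def)
    then show ?thesis
      by (simp add: split G)
  qed
  then have "(\<Sum>s\<in>B \<rightarrow>\<^sub>E S. \<Prod>j\<in>J. F j (s (\<beta> j))) = (\<Prod>b\<in>B. \<Sum>k\<in>S. G b k)"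
    using assms by (simp add: prod_sum_PiE)
  also have "(\<Prod>b\<in>B - \<beta> ` J. \<Sum>k\<in>S. G b k) = (\<Prod>b\<in>B - \<beta> ` J. of_nat (card S))"
    by (rule prod.cong) (auto simp: G_def)
  then have "(\<Prod>b\<in>B. \<Sum>k\<in>S. G b k) =
      of_nat (card S) ^ card (B - \<beta> ` J) * (\<Prod>j\<in>J. \<Sum>k\<in>S. F j k)"
    by (simp add: split G)
  finally show ?thesis .
qed

section \<open>Rotated patterns on a grid\<close>

definition cell :: "nat \<Rightarrow> real \<Rightarrow> nat" where
  "cell L x = nat \<lfloor>real L * x\<rfloor>"

lemma measurable_cell [measurable]: "cell L \<in> borel \<rightarrow>\<^sub>M count_space UNIV"
  unfolding cell_def by measurable

lemma cell_eq_iff: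
  assumes "L > 0" "x \<ge> 0"
  shows "cell L x = c \<longleftrightarrow> real c / L \<le> x \<and> x < (real c + 1) / L"
proof -
  have "cell L x = c \<longleftrightarrow> \<lfloor>real L * x\<rfloor> = int c"
    using assms by (auto simp: cell_def)
  also have "\<dots> \<longleftrightarrow> real c \<le> real L * x \<and> real L * x < real c + 1"
    by (simp add: floor_eq_iff)
  finally show ?thesis
    using assms by (simp add: field_simps)
qed

text \<open>
  A function of the cell is integrated by summing its values. The closed interval contains one
  point of cell number \<open>q\<close>, its right end; hence the two sides of the
  underlying identity of functions agree only almost everywhere.
\<close>

lemma has_bochner_integral_cell:
  fixes g :: "nat \<Rightarrow> real"
  assumes "L > 0" "p \<le> q"
  shows "has_bochner_integral lborel
           (\<lambda>x. indicator {real p / L..real q / L} x * g (cell L x)) ((\<Sum>c\<in>{p..<q}. g c) / L)"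
proof -
  let ?I = "\<lambda>c. {real c / L..<(real c + 1) / L}"
  have "has_bochner_integral lborel (\<lambda>x. \<Sum>c\<in>{p..<q}. indicator (?I c) x * g c)
          (\<Sum>c\<in>{p..<q}. 1 / L * g c)"
  proof (intro has_bochner_integral_sum has_bochner_integral_mult_left)
    fix c
    have "measure lborel (?I c) = (real c + 1) / L - real c / L"
      using assms by (subst measure_lborel_Ico) (auto simp: divide_right_mono)
    also have "\<dots> = 1 / L"
      by (simp add: diff_divide_distrib[symmetric])
    finally show "has_bochner_integral lborel (indicator (?I c)) (1 / L)"
      using has_bochner_integral_real_indicator[of "?I c" lborel]
      using assms by (simp add: divide_right_mono)
  qed
  moreover have "(\<lambda>x. \<Sum>c\<in>{p..<q}. indicator (?I c) x * g c) \<in> borel_measurable lborel"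
    by measurable
  moreover have "(\<lambda>x. indicator {real p / L..real q / L} x * g (cell L x)) \<in> borel_measurable lborel"
    by measurable
  moreover have "AE x in lborel. (\<Sum>c\<in>{p..<q}. indicator (?I c) x * g c) =
      indicator {real p / L..real q / L} x * g (cell L x)"
    using AE_lborel_singleton[of "real q / L"]
  proof eventually_elim
    case (elim x)
    show ?case
    proof (cases "0 \<le> x")
      case True
      have "(\<Sum>c\<in>{p..<q}. indicator (?I c) x * g c) =
          (\<Sum>c\<in>{p..<q}. if c = cell L x then g c else 0)"
      proof (intro sum.cong refl)
        fix c
        have "x \<in> ?I c \<longleftrightarrow> c = cell L x"
          using cell_eq_iff[OF assms(1) True, of c] by auto
        then show "indicator (?I c) x * g c = (if c = cell L x then g c else 0)"
          by (simp only: indicator_def) simp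
      qed
      also have "\<dots> = (if p \<le> cell L x \<and> cell L x < q then g (cell L x) else 0)"
        by simp
      also have "p \<le> cell L x \<and> cell L x < q \<longleftrightarrow> real p / L \<le> x \<and> x \<le> real q / L"
      proof -
        have "p \<le> cell L x \<longleftrightarrow> real p / L \<le> x"
          using True assms by (simp add: cell_def le_nat_iff le_floor_iff field_simps)
        moreover have "cell L x < q \<longleftrightarrow> x < real q / L"
          using True assms by (simp add: cell_def nat_less_iff floor_less_iff field_simps)
        ultimately show ?thesis
          using elim by auto
      qed
      finally show ?thesis
        by (simp add: indicator_def)
    next
      case False
      have "indicator (?I c) x = (0::real)" for c
      proof -
        have "0 \<le> real c / L" by simp
        with False have "x \<notin> ?I c" by (simp only: atLeastLessThan_iff) linarith
        then show ?thesis by simp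
      qed
      moreover have "0 \<le> real p / L" by simp
      with False have "x \<notin> {real p / L..real q / L}"
        by (simp only: atLeastAtMost_iff) linarith
      ultimately show ?thesis
        by simp
    qed
  qed
  ultimately show ?thesis
    by (simp only: has_bochner_integral_cong_AE sum_divide_distrib times_divide_eq_left mult_1_left)
qed

lemma sum_blocks:
  fixes g :: "nat \<Rightarrow> nat \<Rightarrow> 'a::comm_monoid_add"
  assumes "K > 0" "p \<le> q"
  shows "(\<Sum>c\<in>{p * K..<q * K}. g (c div K) (c mod K)) = (\<Sum>b\<in>{p..<q}. \<Sum>i<K. g b i)"
  using assms(2)
proof (induction q rule: dec_induct)
  case (step q)
  have "(\<Sum>c\<in>{p * K..<Suc q * K}. g (c div K) (c mod K)) =
      (\<Sum>c\<in>{p * K..<q * K}. g (c div K) (c mod K)) + (\<Sum>c\<in>{q * K..<Suc q * K}. g (c div K) (c mod K))"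
    using step by (intro sum.atLeastLessThan_concat[symmetric]) auto
  also have "(\<Sum>c\<in>{q * K..<Suc q * K}. g (c div K) (c mod K)) = (\<Sum>i<K. g q i)"
  proof -
    have "(\<Sum>c\<in>{0 + q * K..<K + q * K}. g (c div K) (c mod K)) = (\<Sum>i<K. g q i)"
      unfolding sum.shift_bounds_nat_ivl using assms(1)
      by (intro sum.cong) auto
    then show ?thesis by simp
  qed
  finally show ?case
    using step by simp
qed simp

text \<open>
  The minimum matters only outside the unit interval. It makes the set of blocks finite, so that
  shifts are elements of a finite function space; block number \<open>M\<close> is there for the right
  end of the unit interval.
\<close>

definition block :: "nat \<Rightarrow> nat \<Rightarrow> real \<Rightarrow> nat" where
  "block M K x = min M (cell (M * K) x div K)"

text \<open>
  The position of \<open>x\<close> inside its block after the block has been rotated by its shift.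
\<close>

definition phase :: "nat \<Rightarrow> nat \<Rightarrow> (nat \<Rightarrow> nat) \<Rightarrow> real \<Rightarrow> nat" where
  "phase M K s x = (cell (M * K) x mod K + s (block M K x)) mod K"

lemma measurable_block [measurable]: "block M K \<in> borel \<rightarrow>\<^sub>M count_space UNIV"
  unfolding block_def by measurable

lemma measurable_phase [measurable]: "phase M K s \<in> borel \<rightarrow>\<^sub>M count_space UNIV"
  unfolding phase_def block_def
  by (rule measurable_compose[OF measurable_cell, where g = "\<lambda>c. (c mod K + s (min M (c div K))) mod K"]) simp

lemma block_interval:
  assumes "M > 0" "K > 0" "x \<in> {0..1}"
  shows "x \<in> {real (block M K x) / M..(real (block M K x) + 1) / M}"
proof -
  define c where "c = cell (M * K) x"
  have c: "real c / real (M * K) \<le> x" "x < (real c + 1) / real (M * K)"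
    using cell_eq_iff[of "M * K" x c] assms by (auto simp: c_def)
  have "real c / real (M * K) \<le> 1"
    using c(1) assms(3) by simp
  then have "c \<le> M * K"
    using assms(1,2) by (simp only: divide_le_eq_1_pos of_nat_0_less_iff nat_0_less_mult_iff of_nat_le_iff)
  then have b: "block M K x = c div K"
    using div_le_mono[of c "M * K" K] assms(2) by (simp add: block_def c_def[symmetric])
  have "K * (c div K) \<le> c" "c + 1 \<le> K * (c div K + 1)"
    using assms(2) by (simp, metis add.commute Suc_eq_plus1 Suc_leI dividend_less_times_div mult_Suc_right)
  then have "real K * real (c div K) \<le> real c" "real c + 1 \<le> real K * (real (c div K) + 1)"
    by (metis of_nat_mult of_nat_le_iff, metis of_nat_mult of_nat_le_iff of_nat_add of_nat_1)
  then have "real K * real (c div K) / real (M * K) \<le> real c / real (M * K)"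
      "(real c + 1) / real (M * K) \<le> real K * (real (c div K) + 1) / real (M * K)"
    by (intro divide_right_mono; simp)+
  then have "real (c div K) / M \<le> real c / real (M * K)"
      "(real c + 1) / real (M * K) \<le> (real (c div K) + 1) / M"
    using assms(1,2) by simp_all
  with c b show ?thesis by simp
qed

text \<open>
  Over a union of whole blocks, the integral of a function of the phase does not see the shifts.
  This keeps the design density normalised exactly, and makes the target the same for
  all members of a mixture.
\<close>

lemma has_bochner_integral_phase:
  fixes g :: "nat \<Rightarrow> real"
  assumes "M > 0" "K > 0" "p \<le> q"
  shows "has_bochner_integral lborel
           (\<lambda>x. indicator {real p / M..real q / M} x * g (phase M K s x))
           ((real q - real p) / M * ((\<Sum>i<K. g i) / K))"
proof -
  have "has_bochner_integral lborel
      (\<lambda>x. indicator {real (p * K) / real (M * K)..real (q * K) / real (M * K)} x * g (phase M K s x))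
      ((\<Sum>c\<in>{p * K..<q * K}. g ((c mod K + s (min M (c div K))) mod K)) / real (M * K))"
    unfolding phase_def block_def using assms
    by (intro has_bochner_integral_cell[where g = "\<lambda>c. g ((c mod K + s (min M (c div K))) mod K)"]) auto
  moreover have "(\<Sum>c\<in>{p * K..<q * K}. g ((c mod K + s (min M (c div K))) mod K)) =
      (\<Sum>b\<in>{p..<q}. \<Sum>i<K. g ((i + s (min M b)) mod K))"
    using sum_blocks[OF assms(2,3), of "\<lambda>b i. g ((i + s (min M b)) mod K)"] by simp
  moreover have "\<dots> = real (q - p) * (\<Sum>i<K. g i)"
    using assms(2) by (simp add: sum_cyclic_shift)
  ultimately show ?thesis
    using assms by (simp add: of_nat_diff)
qed

section \<open>The confounded pairs of density and regression function\<close>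

definition design_profile :: "nat \<Rightarrow> nat \<Rightarrow> nat \<Rightarrow> real" where
  "design_profile N k i = (if i < k then real N / real k else real N / (2 * real N - real k))"

definition regression_profile :: "real \<Rightarrow> nat \<Rightarrow> nat \<Rightarrow> real" where
  "regression_profile b k i = (if i < k then b else - b)"

lemma sum_lessThan_if:
  fixes a c :: "'a::comm_semiring_1"
  assumes "k \<le> K"
  shows "(\<Sum>i<K. if i < k then a else c) = of_nat k * a + of_nat (K - k) * c"
proof -
  have "{..<K} \<inter> {i. i < k} = {..<k}" "{..<K} \<inter> - {i. i < k} = {k..<K}"
    using assms by auto
  then show ?thesis
    by (simp add: sum.If_cases)
qed

lemma sum_design_profile:
  assumes "0 < k" "k < 2 * N"
  shows "(\<Sum>i<2 * N. design_profile N k i) = 2 * real N"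
  using assms by (simp add: design_profile_def sum_lessThan_if of_nat_diff)

lemma sum_regression_profile:
  assumes "k \<le> 2 * N"
  shows "(\<Sum>i<2 * N. regression_profile b k i) = 2 * b * (real k - real N)"
  using assms by (simp add: regression_profile_def sum_lessThan_if of_nat_diff algebra_simps)

text \<open>
  The plus cells and the minus cells of a block carry equal mass whatever their number \<open>k\<close>
  is. So a single observation from a randomly rotated pattern tells nothing about \<open>k\<close>.
\<close>

lemma sum_profiles_independent_of_split:
  fixes F :: "real \<Rightarrow> ennreal"
  assumes "0 < k" "k < 2 * N"
  shows "(\<Sum>i<2 * N. ennreal (design_profile N k i) * F (regression_profile b k i)) =
         of_nat N * (F b + F (- b))"
proof -
  have "(\<Sum>i<2 * N. ennreal (design_profile N k i) * F (regression_profile b k i)) =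
      (\<Sum>i<2 * N. if i < k then ennreal (real N / k) * F b
                   else ennreal (real N / (2 * real N - k)) * F (- b))"
    by (intro sum.cong refl) (simp add: design_profile_def regression_profile_def)
  also have "\<dots> = (of_nat k * ennreal (real N / k)) * F b +
      (of_nat (2 * N - k) * ennreal (real N / (2 * real N - k))) * F (- b)"
    using assms by (simp add: sum_lessThan_if mult.assoc)
  also have "of_nat k * ennreal (real N / k) = of_nat N"
    using assms by (simp add: ennreal_of_nat_eq_real_of_nat flip: ennreal_mult')
  also have "of_nat (2 * N - k) * ennreal (real N / (2 * real N - k)) = of_nat N"
    using assms by (simp add: ennreal_of_nat_eq_real_of_nat of_nat_diff flip: ennreal_mult')
  finally show ?thesis
    by (simp add: distrib_left)
qed

section \<open>The joint density of the sample\<close>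

lemma density_PiM:
  fixes p :: "'a \<Rightarrow> ennreal"
  assumes "finite I" "sigma_finite_measure M" "sigma_finite_measure (density M p)"
    and p [measurable]: "p \<in> borel_measurable M"
  shows "density (PiM I (\<lambda>_. M)) (\<lambda>x. \<Prod>i\<in>I. p (x i)) = PiM I (\<lambda>_. density M p)"
proof -
  interpret M: product_sigma_finite "\<lambda>_. M"
    using assms by (simp add: product_sigma_finite_def)
  interpret D: product_sigma_finite "\<lambda>_. density M p"
    using assms by (simp add: product_sigma_finite_def)
  show ?thesis
  proof (rule D.PiM_eqI[OF assms(1)])
    show "sets (density (PiM I (\<lambda>_. M)) (\<lambda>x. \<Prod>i\<in>I. p (x i))) = sets (PiM I (\<lambda>_. density M p))"
      by (simp cong: sets_PiM_cong)
  next
    fix A assume "\<And>i. i \<in> I \<Longrightarrow> A i \<in> sets (density M p)"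
    then have A [measurable]: "\<And>i. i \<in> I \<Longrightarrow> A i \<in> sets M" by simp
    have PA [measurable]: "Pi\<^sub>E I A \<in> sets (PiM I (\<lambda>_. M))"
      using A assms(1) by (intro sets_PiM_I_finite) auto
    have "emeasure (density (PiM I (\<lambda>_. M)) (\<lambda>x. \<Prod>i\<in>I. p (x i))) (Pi\<^sub>E I A) =
        (\<integral>\<^sup>+x. (\<Prod>i\<in>I. p (x i)) * indicator (Pi\<^sub>E I A) x \<partial>PiM I (\<lambda>_. M))"
      by (rule emeasure_density) (use PA in simp_all)
    also have "\<dots> = (\<integral>\<^sup>+x. (\<Prod>i\<in>I. p (x i) * indicator (A i) (x i)) \<partial>PiM I (\<lambda>_. M))"
    proof (rule nn_integral_cong)
      fix x assume x: "x \<in> space (PiM I (\<lambda>_. M))"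
      have "indicator (Pi\<^sub>E I A) x = (\<Prod>i\<in>I. indicator (A i) (x i) :: ennreal)"
      proof (cases "x \<in> Pi\<^sub>E I A")
        case True
        then show ?thesis by (auto simp: PiE_iff intro!: prod.neutral[symmetric])
      next
        case False
        then obtain i where "i \<in> I" "x i \<notin> A i"
          using x by (auto simp: space_PiM PiE_iff)
        then show ?thesis
          using False assms(1) by (auto simp: prod_zero_iff indicator_def)
      qed
      then show "(\<Prod>i\<in>I. p (x i)) * indicator (Pi\<^sub>E I A) x = (\<Prod>i\<in>I. p (x i) * indicator (A i) (x i))"
        by (simp add: prod.distrib)
    qed
    also have "\<dots> = (\<Prod>i\<in>I. \<integral>\<^sup>+x. p x * indicator (A i) x \<partial>M)"
      using assms(1) by (intro M.product_nn_integral_prod) measurable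
    also have "\<dots> = (\<Prod>i\<in>I. emeasure (density M p) (A i))"
      using A by (intro prod.cong refl) (simp add: emeasure_density)
    finally show "emeasure (density (PiM I (\<lambda>_. M)) (\<lambda>x. \<Prod>i\<in>I. p (x i))) (Pi\<^sub>E I A) =
        (\<Prod>i\<in>I. emeasure (density M p) (A i))" .
  qed
qed

abbreviation obs_space :: "(real \<times> real) measure" where
  "obs_space \<equiv> lborel \<Otimes>\<^sub>M lborel"

definition obs_density :: "(real \<Rightarrow> real) \<Rightarrow> (real \<Rightarrow> real) \<Rightarrow> real \<times> real \<Rightarrow> ennreal" where
  "obs_density f h x =
     indicator {0..1} (snd x) * ennreal (f (snd x)) * ennreal (std_normal_density (fst x - h (snd x)))"

lemma measurable_obs_density [measurable]:
  assumes [measurable]: "f \<in> borel_measurable borel" "h \<in> borel_measurable borel"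
  shows "obs_density f h \<in> borel_measurable obs_space"
  unfolding obs_density_def by measurable

lemma measurable_observation:
  assumes [measurable]: "h \<in> borel_measurable borel"
  shows "(\<lambda>p. (h (fst p) + snd p, fst p)) \<in>
    design_measure f \<Otimes>\<^sub>M noise_measure \<rightarrow>\<^sub>M borel \<Otimes>\<^sub>M borel"
proof -
  have sets_N: "sets noise_measure = sets borel" by (simp add: noise_measure_def)
  have sets_D: "sets (design_measure f) = sets (restrict_space borel {0..1})"
    by (rule sets_design_measure)
  have id: "(\<lambda>x. x) \<in> design_measure f \<rightarrow>\<^sub>M borel"
    by (subst measurable_cong_sets[OF sets_D refl]) (auto intro: measurable_restrict_space1)
  have fst_m: "fst \<in> design_measure f \<Otimes>\<^sub>M noise_measure \<rightarrow>\<^sub>M borel"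
    by (rule measurable_compose[OF measurable_fst id])
  have snd_m: "snd \<in> design_measure f \<Otimes>\<^sub>M noise_measure \<rightarrow>\<^sub>M borel"
    using measurable_snd[of "design_measure f" noise_measure]
    by (simp add: measurable_cong_sets[OF refl sets_N])
  note [measurable] = fst_m snd_m
  show ?thesis by measurable
qed

text \<open>
  Given the design point, the response is a translate of the noise by the regression value.
\<close>

lemma distr_observation:
  assumes [measurable]: "f \<in> borel_measurable borel" "h \<in> borel_measurable borel"
  shows "distr (design_measure f \<Otimes>\<^sub>M noise_measure) (borel \<Otimes>\<^sub>M borel)
           (\<lambda>p. (h (fst p) + snd p, fst p)) = density obs_space (obs_density f h)"
proof (rule measure_eqI)
  fix A assume "A \<in> sets (distr (design_measure f \<Otimes>\<^sub>M noise_measure) (borel \<Otimes>\<^sub>M borel)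
           (\<lambda>p. (h (fst p) + snd p, fst p)))"
  then have A: "A \<in> sets (borel \<Otimes>\<^sub>M borel)" by simp
  then have A' [measurable]: "A \<in> sets (lborel \<Otimes>\<^sub>M lborel)"
    by (simp cong: sets_pair_measure_cong)
  interpret noise: prob_space noise_measure by (rule prob_space_noise_measure)
  note m = measurable_observation[OF assms(2), of f]
  have noise: "(\<integral>\<^sup>+e. indicator A (h z + e, z) \<partial>noise_measure) =
      (\<integral>\<^sup>+u. ennreal (std_normal_density (u - h z)) * indicator A (u, z) \<partial>lborel)" for z
  proof -
    have "(\<integral>\<^sup>+e. indicator A (h z + e, z) \<partial>noise_measure) =
        (\<integral>\<^sup>+e. ennreal (std_normal_density e) * indicator A (h z + e, z) \<partial>lborel)"
      unfolding noise_measure_def by (intro nn_integral_density) (use A in measurable)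
    also have "\<dots> = (\<integral>\<^sup>+u. ennreal (std_normal_density (u - h z)) * indicator A (u, z) \<partial>lborel)"
      by (subst nn_integral_real_affine[where c = 1 and t = "h z"]) (use A in simp_all)
    finally show ?thesis .
  qed
  have "emeasure (distr (design_measure f \<Otimes>\<^sub>M noise_measure) (borel \<Otimes>\<^sub>M borel)
           (\<lambda>p. (h (fst p) + snd p, fst p))) A =
      (\<integral>\<^sup>+p. indicator A (h (fst p) + snd p, fst p) \<partial>(design_measure f \<Otimes>\<^sub>M noise_measure))"
    (is "?l = _")
  proof -
    have "?l = (\<integral>\<^sup>+y. indicator A y \<partial>distr (design_measure f \<Otimes>\<^sub>M noise_measure)
        (borel \<Otimes>\<^sub>M borel) (\<lambda>p. (h (fst p) + snd p, fst p)))"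
      using A by simp
    also have "\<dots> = (\<integral>\<^sup>+p. indicator A (h (fst p) + snd p, fst p) \<partial>(design_measure f \<Otimes>\<^sub>M noise_measure))"
      using A by (intro nn_integral_distr[OF m]) (simp add: borel_measurable_indicator)
    finally show ?thesis .
  qed
  also have "\<dots> = (\<integral>\<^sup>+z. \<integral>\<^sup>+e. indicator A (h z + e, z) \<partial>noise_measure \<partial>design_measure f)"
    by (subst noise.nn_integral_fst[symmetric])
       (use measurable_compose[OF m borel_measurable_indicator[OF A]] in simp_all)
  also have "\<dots> = (\<integral>\<^sup>+z. (\<integral>\<^sup>+u. ennreal (std_normal_density (u - h z)) * indicator A (u, z) \<partial>lborel) \<partial>design_measure f)"
    by (simp add: noise)
  also have "\<dots> = (\<integral>\<^sup>+z\<in>{0..1}. ennreal (f z) *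
      (\<integral>\<^sup>+u. ennreal (std_normal_density (u - h z)) * indicator A (u, z) \<partial>lborel) \<partial>lborel)"
    unfolding design_measure_def
    by (subst nn_integral_density)
       (auto simp: nn_integral_restrict_space intro!: measurable_restrict_space1)
  also have "\<dots> = (\<integral>\<^sup>+z. (\<integral>\<^sup>+u. obs_density f h (u, z) * indicator A (u, z) \<partial>lborel) \<partial>lborel)"
    by (auto simp: obs_density_def nn_integral_cmult[symmetric] mult_ac intro!: nn_integral_cong
        split: split_indicator)
  also have "\<dots> = (\<integral>\<^sup>+x. obs_density f h x * indicator A x \<partial>obs_space)"
    by (rule lborel_pair.nn_integral_snd) measurable
  also have "\<dots> = emeasure (density obs_space (obs_density f h)) A"
    by (rule emeasure_density[OF measurable_obs_density[OF assms] A', symmetric])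
  finally show "emeasure (distr (design_measure f \<Otimes>\<^sub>M noise_measure) (borel \<Otimes>\<^sub>M borel)
           (\<lambda>p. (h (fst p) + snd p, fst p))) A = emeasure (density obs_space (obs_density f h)) A" .
qed (simp cong: sets_pair_measure_cong)

lemma prob_space_observation:
  assumes f: "f \<in> borel_measurable borel" "f \<in> density_class \<rho> \<rho>bar"
    and h: "h \<in> borel_measurable borel"
  shows "prob_space (density obs_space (obs_density f h))"
proof -
  have "prob_space (design_measure f \<Otimes>\<^sub>M noise_measure)"
    by (intro prob_space_pair prob_space_design_measure[OF f(2)] prob_space_noise_measure)
  then show ?thesis
    unfolding distr_observation[OF f(1) h, symmetric]
    using measurable_observation[OF h] by (rule prob_space.prob_space_distr)
qed

lemma distr_sample:
  assumes f: "f \<in> borel_measurable borel" "f \<in> density_class \<rho> \<rho>bar"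
    and h: "h \<in> borel_measurable borel" "h \<in> regression_class \<rho>til"
  shows "distr (model_space n f) (\<Pi>\<^sub>M j\<in>{1..n}. borel \<Otimes>\<^sub>M borel) (sample n h) =
         density (\<Pi>\<^sub>M j\<in>{1..n}. obs_space) (\<lambda>x. \<Prod>j\<in>{1..n}. obs_density f h (x j))"
proof -
  let ?M = "design_measure f \<Otimes>\<^sub>M noise_measure" and ?g = "\<lambda>p. (h (fst p) + snd p, fst p)"
  let ?D = "density obs_space (obs_density f h)"
  have law: "distr ?M (borel \<Otimes>\<^sub>M borel) ?g = ?D"
    by (rule distr_observation[OF f(1) h(1)])
  have sets_D: "sets ?D = sets (borel \<Otimes>\<^sub>M borel)"
    by (simp cong: sets_pair_measure_cong)
  have prob_M: "prob_space ?M"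
    by (intro prob_space_pair prob_space_design_measure[OF f(2)] prob_space_noise_measure)
  have g: "?g \<in> ?M \<rightarrow>\<^sub>M borel \<Otimes>\<^sub>M borel"
    by (rule measurable_observation[OF h(1)])
  have prob_D: "prob_space ?D"
    by (rule prob_space_observation[OF f h(1)])
  have "distr (model_space n f) (\<Pi>\<^sub>M j\<in>{1..n}. borel \<Otimes>\<^sub>M borel) (sample n h) =
      distr (\<Pi>\<^sub>M j\<in>{1..n}. ?M) (\<Pi>\<^sub>M j\<in>{1..n}. ?D) (compose {1..n} ?g)"
    using sets_D
    by (intro distr_cong) (auto simp: model_space_def sample_def compose_def intro!: sets_PiM_cong)
  also have "\<dots> = (\<Pi>\<^sub>M j\<in>{1..n}. distr ?M ?D ?g)"
    using g prob_M prob_D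
    by (intro distr_PiM_finite_prob_space') (simp_all add: measurable_cong_sets[OF refl sets_D])
  also have "distr ?M ?D ?g = ?D"
    using law by (simp add: distr_cong[OF refl sets_D refl])
  also have "(\<Pi>\<^sub>M j\<in>{1..n}. ?D) =
      density (\<Pi>\<^sub>M j\<in>{1..n}. obs_space) (\<lambda>x. \<Prod>j\<in>{1..n}. obs_density f h (x j))"
    using prob_D f(1) h(1)
    by (intro density_PiM[symmetric] prob_space_imp_sigma_finite
        sigma_finite_pair_measure sigma_finite_lborel) auto
  finally show ?thesis .
qed

lemma mse_eq_nn_integral_density:
  assumes f: "f \<in> borel_measurable borel" "f \<in> density_class \<rho> \<rho>bar"
    and h: "h \<in> borel_measurable borel" "h \<in> regression_class \<rho>til"
    and T: "estimator n T"
  shows "mse n f h T \<theta> =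
    (\<integral>\<^sup>+x. (\<Prod>j\<in>{1..n}. obs_density f h (x j)) * ennreal (\<bar>T x - \<theta>\<bar>\<^sup>2) \<partial>(\<Pi>\<^sub>M j\<in>{1..n}. obs_space))"
proof -
  have T1: "T \<in> borel_measurable (\<Pi>\<^sub>M j\<in>{1..n}. borel \<Otimes>\<^sub>M borel)"
    using T by (simp add: estimator_def)
  have "sets (\<Pi>\<^sub>M j\<in>{1..n}. borel \<Otimes>\<^sub>M borel :: (real \<times> real) measure) = sets (\<Pi>\<^sub>M j\<in>{1..n}. obs_space)"
    by (intro sets_PiM_cong sets_pair_measure_cong) auto
  then have T2 [measurable]: "T \<in> borel_measurable (\<Pi>\<^sub>M j\<in>{1..n}. obs_space)"
    using T1 by (subst (asm) measurable_cong_sets) auto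
  note [measurable] = T1 f(1) h(1)
  have "mse n f h T \<theta> =
      (\<integral>\<^sup>+x. ennreal (\<bar>T x - \<theta>\<bar>\<^sup>2) \<partial>distr (model_space n f) (\<Pi>\<^sub>M j\<in>{1..n}. borel \<Otimes>\<^sub>M borel) (sample n h))"
    unfolding mse_def by (intro nn_integral_distr[symmetric] measurable_sample[OF h(2)]) measurable
  also have "\<dots> = (\<integral>\<^sup>+x. (\<Prod>j\<in>{1..n}. obs_density f h (x j)) * ennreal (\<bar>T x - \<theta>\<bar>\<^sup>2) \<partial>(\<Pi>\<^sub>M j\<in>{1..n}. obs_space))"
    unfolding distr_sample[OF f h] by (rule nn_integral_density) measurable
  finally show ?thesis .
qed

section \<open>Observations in distinct blocks\<close>

text \<open>
  Union bound over the pairs of indices and the possible common values of \<open>\<beta>\<close>.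
\<close>

lemma emeasure_collision_le:
  assumes D: "prob_space D" and \<beta> [measurable]: "\<beta> \<in> D \<rightarrow>\<^sub>M count_space UNIV"
    and fin: "finite I" "finite B" and B: "\<And>x. x \<in> space D \<Longrightarrow> \<beta> x \<in> B"
    and q: "\<And>b. b \<in> B \<Longrightarrow> emeasure D {x \<in> space D. \<beta> x = b} \<le> ennreal q" "q \<ge> 0"
  shows "emeasure (\<Pi>\<^sub>M i\<in>I. D) {x \<in> space (\<Pi>\<^sub>M i\<in>I. D). \<not> inj_on (\<lambda>i. \<beta> (x i)) I}
           \<le> ennreal ((real (card I))\<^sup>2 * real (card B) * q\<^sup>2)"
proof -
  interpret D: prob_space D by fact
  interpret P: product_sigma_finite "\<lambda>_. D"
    by (simp add: product_sigma_finite_def D.sigma_finite_measure_axioms)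
  define A where "A = (\<lambda>(b, i, j). \<Pi>\<^sub>E k\<in>I. if k = i \<or> k = j then {x \<in> space D. \<beta> x = b} else space D)"
  define J where "J = {(i, j). i \<in> I \<and> j \<in> I \<and> i \<noteq> j}"
  have J: "J \<subseteq> I \<times> I" by (auto simp: J_def)
  then have finJ: "finite J" using fin finite_subset by blast
  have "card J \<le> card I * card I"
    using card_mono[OF _ J] fin by (simp add: card_cartesian_product)
  then have cardJ: "real (card J) \<le> (real (card I))\<^sup>2"
    unfolding power2_eq_square by (metis of_nat_le_iff of_nat_mult)
  have sets_A: "A t \<in> sets (\<Pi>\<^sub>M i\<in>I. D)" for t
    unfolding A_def using fin by (cases t) (auto intro!: sets_PiM_I_finite)
  have A_le: "emeasure (\<Pi>\<^sub>M i\<in>I. D) (A t) \<le> ennreal (q\<^sup>2)" if t: "t \<in> B \<times> J" for t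
  proof -
    obtain b i j where t': "t = (b, i, j)" "b \<in> B" "i \<in> I" "j \<in> I" "i \<noteq> j"
      using t by (auto simp: J_def)
    let ?S = "\<lambda>k. if k = i \<or> k = j then {x \<in> space D. \<beta> x = b} else space D"
    have "emeasure (\<Pi>\<^sub>M i\<in>I. D) (A t) = (\<Prod>k\<in>I. emeasure D (?S k))"
      unfolding t' A_def prod.case using fin by (intro P.emeasure_PiM) auto
    also have "\<dots> = (\<Prod>k\<in>{i, j}. emeasure D (?S k))"
      using fin t' by (intro prod.mono_neutral_right) (auto simp: D.emeasure_space_1)
    also have "\<dots> \<le> ennreal q * ennreal q"
      using t' q(1)[of b] by (auto intro!: mult_mono)
    also have "\<dots> = ennreal (q\<^sup>2)"
      using q(2) by (simp add: ennreal_mult power2_eq_square)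
    finally show ?thesis .
  qed
  have "{x \<in> space (\<Pi>\<^sub>M i\<in>I. D). \<not> inj_on (\<lambda>i. \<beta> (x i)) I} \<subseteq> (\<Union>t\<in>B \<times> J. A t)"
  proof
    fix x assume "x \<in> {x \<in> space (\<Pi>\<^sub>M i\<in>I. D). \<not> inj_on (\<lambda>i. \<beta> (x i)) I}"
    then obtain i j where x: "x \<in> (\<Pi>\<^sub>E i\<in>I. space D)" "i \<in> I" "j \<in> I" "i \<noteq> j" "\<beta> (x i) = \<beta> (x j)"
      by (auto simp: inj_on_def space_PiM)
    then have "x \<in> A (\<beta> (x i), i, j)"
      by (auto simp: A_def PiE_iff)
    moreover have "(\<beta> (x i), i, j) \<in> B \<times> J"
      using x B by (auto simp: J_def PiE_iff)
    ultimately show "x \<in> (\<Union>t\<in>B \<times> J. A t)" by blast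
  qed
  then have "emeasure (\<Pi>\<^sub>M i\<in>I. D) {x \<in> space (\<Pi>\<^sub>M i\<in>I. D). \<not> inj_on (\<lambda>i. \<beta> (x i)) I}
      \<le> emeasure (\<Pi>\<^sub>M i\<in>I. D) (\<Union>t\<in>B \<times> J. A t)"
    using sets_A fin finJ by (intro emeasure_mono) auto
  also have "\<dots> \<le> (\<Sum>t\<in>B \<times> J. emeasure (\<Pi>\<^sub>M i\<in>I. D) (A t))"
    using sets_A fin finJ by (intro emeasure_subadditive_finite) auto
  also have "\<dots> \<le> (\<Sum>t\<in>B \<times> J. ennreal (q\<^sup>2))"
    by (intro sum_mono A_le)
  also have "\<dots> = ennreal (real (card J) * real (card B) * q\<^sup>2)"
    by (simp add: card_cartesian_product ennreal_of_nat_eq_real_of_nat mult.commute flip: ennreal_mult')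
  also have "\<dots> \<le> ennreal ((real (card I))\<^sup>2 * real (card B) * q\<^sup>2)"
    using cardJ by (intro ennreal_leI mult_right_mono) auto
  finally show ?thesis .
qed

lemma const_one_in_density_class: "(\<lambda>_. 1) \<in> density_class 1 1"
  by (simp add: density_class_def)

text \<open>
  The noise is integrated out first. What remains is the length of a block.
\<close>

lemma emeasure_observation_in_block_le:
  assumes h [measurable]: "h \<in> borel_measurable borel" and "M > 0" "K > 0"
  shows "emeasure (density obs_space (obs_density (\<lambda>_. 1) h)) {x. block M K (snd x) = b} \<le> ennreal (1 / M)"
proof -
  let ?B = "{z. block M K z = b}"
  have normal: "(\<integral>\<^sup>+u. ennreal (std_normal_density (u - \<mu>)) \<partial>lborel) = 1" for \<mu>
  proof -
    interpret prob_space "density lborel (normal_density \<mu> 1)"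
      by (rule prob_space_normal_density) simp
    show ?thesis
      using emeasure_space_1 by (simp add: emeasure_density normal_density_def)
  qed
  have "Measurable.pred obs_space (\<lambda>x. block M K (snd x) = b)"
    by measurable
  then have B: "{x. block M K (snd x) = b} \<in> sets obs_space"
    unfolding pred_def by (simp only: space_pair_measure space_lborel space_borel UNIV_Times_UNIV UNIV_I simp_thms)
  have "emeasure (density obs_space (obs_density (\<lambda>_. 1) h)) {x. block M K (snd x) = b} =
      (\<integral>\<^sup>+x. obs_density (\<lambda>_. 1) h x * indicator {x. block M K (snd x) = b} x \<partial>obs_space)"
    by (intro emeasure_density B measurable_obs_density) auto
  also have "\<dots> = (\<integral>\<^sup>+x. obs_density (\<lambda>_. 1) h x * indicator ?B (snd x) \<partial>obs_space)"
    by (simp add: indicator_def)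
  also have "\<dots> = (\<integral>\<^sup>+z. \<integral>\<^sup>+u. obs_density (\<lambda>_. 1) h (u, z) * indicator ?B z \<partial>lborel \<partial>lborel)"
    by (subst lborel_pair.nn_integral_snd[symmetric]) auto
  also have "\<dots> = (\<integral>\<^sup>+z. indicator {0..1} z * indicator ?B z \<partial>lborel)"
    by (intro nn_integral_cong)
       (simp add: obs_density_def nn_integral_cmult nn_integral_multc normal)
  also have "\<dots> \<le> (\<integral>\<^sup>+z. indicator {real b / M..(real b + 1) / M} z \<partial>lborel)"
    using block_interval[OF assms(2,3)]
    by (intro nn_integral_mono) (auto simp: indicator_def)
  also have "\<dots> = ennreal (1 / M)"
    by (simp add: divide_right_mono diff_divide_distrib[symmetric])
  finally show ?thesis .
qed

definition distinct_blocks :: "nat \<Rightarrow> nat \<Rightarrow> nat \<Rightarrow> (nat \<Rightarrow> real \<times> real) set" where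
  "distinct_blocks n M K =
     {x \<in> space (\<Pi>\<^sub>M j\<in>{1..n}. obs_space). inj_on (\<lambda>j. block M K (snd (x j))) {1..n}}"

lemma sets_distinct_blocks [measurable]: "distinct_blocks n M K \<in> sets (\<Pi>\<^sub>M j\<in>{1..n}. obs_space)"
  unfolding distinct_blocks_def inj_on_def by measurable

text \<open>
  A collision costs at most \<open>n\<^sup>2 (M + 1) / M\<^sup>2\<close>, which is at most
  \<open>2 n\<^sup>2 / M\<close>. This fixes the number of blocks.
\<close>

lemma distinct_blocks_likely:
  assumes h [measurable]: "h \<in> borel_measurable borel" and "n > 0" "K > 0" and M: "M = 4 * n\<^sup>2"
  shows "(\<integral>\<^sup>+x. (\<Prod>j\<in>{1..n}. obs_density (\<lambda>_. 1) h (x j)) * indicator (distinct_blocks n M K) x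
           \<partial>(\<Pi>\<^sub>M j\<in>{1..n}. obs_space)) \<ge> ennreal (1 / 2)"
proof -
  let ?D = "density obs_space (obs_density (\<lambda>_. 1) h)" and ?G = "distinct_blocks n M K"
  let ?P = "\<Pi>\<^sub>M j\<in>{1..n}. ?D"
  have D: "prob_space ?D"
    by (rule prob_space_observation[OF _ const_one_in_density_class]) auto
  have P: "?P = density (\<Pi>\<^sub>M j\<in>{1..n}. obs_space) (\<lambda>x. \<Prod>j\<in>{1..n}. obs_density (\<lambda>_. 1) h (x j))"
    using D by (intro density_PiM[symmetric] prob_space_imp_sigma_finite
        sigma_finite_pair_measure sigma_finite_lborel) auto
  interpret P: prob_space ?P
    using D by (intro prob_space_PiM)
  have space_P: "space ?P = space (\<Pi>\<^sub>M j\<in>{1..n}. obs_space)"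
    by (simp add: space_PiM)
  have G: "?G \<in> sets ?P"
    unfolding P by (simp only: sets_density sets_distinct_blocks)
  have "M > 0" using M \<open>n > 0\<close> by simp
  have "emeasure ?P (space ?P - ?G) =
      emeasure ?P {x \<in> space ?P. \<not> inj_on (\<lambda>j. block M K (snd (x j))) {1..n}}"
    unfolding distinct_blocks_def space_P by (rule arg_cong[where f = "emeasure ?P"]) auto
  also have "\<dots> \<le> ennreal ((real (card {1..n}))\<^sup>2 * real (card {..M}) * (1 / M)\<^sup>2)"
    using D emeasure_observation_in_block_le[OF h \<open>M > 0\<close> \<open>K > 0\<close>]
    by (intro emeasure_collision_le) (auto simp: block_def space_pair_measure)
  also have "\<dots> \<le> ennreal (1 / 2)"
  proof (rule ennreal_leI)
    have "real M \<ge> 1" using \<open>M > 0\<close> by simp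
    then have "real M * (real M + 1) \<le> real M * (2 * real M)"
      by (intro mult_left_mono) auto
    moreover have "real M = 4 * (real n)\<^sup>2" using M by simp
    ultimately have "(real n)\<^sup>2 * (real M + 1) \<le> 1 / 2 * (real M)\<^sup>2"
      by (simp add: power2_eq_square)
    then show "(real (card {1..n}))\<^sup>2 * real (card {..M}) * (1 / M)\<^sup>2 \<le> 1 / 2"
      using \<open>M > 0\<close> by (simp add: field_simps)
  qed
  finally have "ennreal (P.prob (space ?P - ?G)) \<le> ennreal (1 / 2)"
    by (simp only: P.emeasure_eq_measure)
  then have "P.prob (space ?P - ?G) \<le> 1 / 2"
    by (subst (asm) ennreal_le_iff) auto
  then have "1 / 2 \<le> P.prob ?G"
    using P.prob_compl[OF G] by simp
  then have "ennreal (1 / 2) \<le> emeasure ?P ?G"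
    unfolding P.emeasure_eq_measure by (rule ennreal_leI)
  also have "emeasure ?P ?G = (\<integral>\<^sup>+x. (\<Prod>j\<in>{1..n}. obs_density (\<lambda>_. 1) h (x j)) * indicator ?G x
           \<partial>(\<Pi>\<^sub>M j\<in>{1..n}. obs_space))"
    unfolding P by (rule emeasure_density[OF _ sets_distinct_blocks]) measurable
  finally show ?thesis .
qed

section \<open>Lower bound for the risk\<close>

text \<open>
  Le Cam's two-point method for two families of densities \<open>w\<^sub>1\<close>, \<open>w\<^sub>2\<close>
  whose sums over \<open>S\<close> agree on an event \<open>G\<close>. On \<open>G\<close> the two squared errors are integrated
  against the same mixture, and they add up to at least half the squared distance of the
  targets at every point.
\<close>

lemma two_mixtures_lower_bound:
  fixes w\<^sub>1 w\<^sub>2 :: "'s \<Rightarrow> 'a \<Rightarrow> ennreal" and T :: "'a \<Rightarrow> real"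
  assumes S: "finite S" "S \<noteq> {}" and G [measurable]: "G \<in> sets M" and T [measurable]: "T \<in> borel_measurable M"
    and w [measurable]: "\<And>s. s \<in> S \<Longrightarrow> w\<^sub>1 s \<in> borel_measurable M" "\<And>s. s \<in> S \<Longrightarrow> w\<^sub>2 s \<in> borel_measurable M"
    and eq: "\<And>x. x \<in> G \<Longrightarrow> (\<Sum>s\<in>S. w\<^sub>1 s x) = (\<Sum>s\<in>S. w\<^sub>2 s x)"
    and mass: "\<And>s. s \<in> S \<Longrightarrow> (\<integral>\<^sup>+x. w\<^sub>1 s x * indicator G x \<partial>M) \<ge> ennreal (1 / 2)"
    and R: "\<And>s. s \<in> S \<Longrightarrow> (\<integral>\<^sup>+x. w\<^sub>1 s x * ennreal (\<bar>T x - \<theta>\<^sub>1\<bar>\<^sup>2) \<partial>M) \<le> R"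
      "\<And>s. s \<in> S \<Longrightarrow> (\<integral>\<^sup>+x. w\<^sub>2 s x * ennreal (\<bar>T x - \<theta>\<^sub>2\<bar>\<^sup>2) \<partial>M) \<le> R"
  shows "ennreal ((\<theta>\<^sub>1 - \<theta>\<^sub>2)\<^sup>2 / 8) \<le> R"
proof (cases R)
  case (real r)
  let ?d = "(\<theta>\<^sub>1 - \<theta>\<^sub>2)\<^sup>2 / 2"
  let ?W = "\<lambda>x. \<Sum>s\<in>S. w\<^sub>1 s x"
  have split: "?d \<le> \<bar>t - \<theta>\<^sub>1\<bar>\<^sup>2 + \<bar>t - \<theta>\<^sub>2\<bar>\<^sup>2" for t :: real
  proof -
    have "\<bar>t - \<theta>\<^sub>1\<bar>\<^sup>2 + \<bar>t - \<theta>\<^sub>2\<bar>\<^sup>2 - ?d = ((t - \<theta>\<^sub>1) + (t - \<theta>\<^sub>2))\<^sup>2 / 2"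
      by (simp add: power2_eq_square field_simps)
    moreover have "0 \<le> ((t - \<theta>\<^sub>1) + (t - \<theta>\<^sub>2))\<^sup>2 / 2" by simp
    ultimately show ?thesis by linarith
  qed
  have "ennreal (real (card S) * (1 / 2 * ?d)) = (\<Sum>s\<in>S. ennreal (1 / 2)) * ennreal ?d"
    by (subst sum_ennreal, simp, subst ennreal_mult[symmetric]) (auto simp: sum_nonneg)
  also have "\<dots> \<le> (\<Sum>s\<in>S. \<integral>\<^sup>+x. w\<^sub>1 s x * indicator G x \<partial>M) * ennreal ?d"
    by (intro mult_right_mono sum_mono mass) auto
  also have "\<dots> = (\<integral>\<^sup>+x. (?W x * indicator G x) * ennreal ?d \<partial>M)"
    by (simp add: nn_integral_sum nn_integral_multc sum_distrib_right)
  also have "\<dots> \<le> (\<integral>\<^sup>+x. (?W x * indicator G x) * (ennreal (\<bar>T x - \<theta>\<^sub>1\<bar>\<^sup>2) + ennreal (\<bar>T x - \<theta>\<^sub>2\<bar>\<^sup>2)) \<partial>M)"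
    using split by (intro nn_integral_mono mult_left_mono) (auto simp flip: ennreal_plus intro!: ennreal_leI)
  also have "\<dots> \<le> (\<integral>\<^sup>+x. (\<Sum>s\<in>S. w\<^sub>1 s x * ennreal (\<bar>T x - \<theta>\<^sub>1\<bar>\<^sup>2)) +
                    (\<Sum>s\<in>S. w\<^sub>2 s x * ennreal (\<bar>T x - \<theta>\<^sub>2\<bar>\<^sup>2)) \<partial>M)"
    using eq by (intro nn_integral_mono) (auto simp: indicator_def distrib_left sum_distrib_right[symmetric])
  also have "\<dots> = (\<Sum>s\<in>S. \<integral>\<^sup>+x. w\<^sub>1 s x * ennreal (\<bar>T x - \<theta>\<^sub>1\<bar>\<^sup>2) \<partial>M) +
                  (\<Sum>s\<in>S. \<integral>\<^sup>+x. w\<^sub>2 s x * ennreal (\<bar>T x - \<theta>\<^sub>2\<bar>\<^sup>2) \<partial>M)"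
    by (simp add: nn_integral_add nn_integral_sum)
  also have "\<dots> \<le> (\<Sum>s\<in>S. R) + (\<Sum>s\<in>S. R)"
    by (intro add_mono sum_mono R)
  also have "\<dots> = ennreal (real (card S) * (2 * r))"
    using real by (simp add: ennreal_of_nat_eq_real_of_nat flip: ennreal_mult' ennreal_plus)
  finally have "real (card S) * (1 / 2 * ?d) \<le> real (card S) * (2 * r)"
    using real by (subst (asm) ennreal_le_iff) auto
  moreover have "real (card S) > 0"
    using S by (simp add: card_gt_0_iff)
  ultimately have "1 / 2 * ?d \<le> 2 * r"
    by (simp only: mult_le_cancel_left_pos)
  then show ?thesis
    using real by (auto intro!: ennreal_leI)
qed auto

text \<open>
  The confounding identity: for design points in distinct blocks the right-hand side is free of
  \<open>k\<close>. Summing over the shift of a block moves the design point through all positions of the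
  pattern, and the total over all positions does not depend on \<open>k\<close>.
\<close>

lemma sum_obs_density_over_shifts:
  assumes "0 < k" "k < 2 * N" and inj: "inj_on (\<lambda>j. block M (2 * N) (snd (x j))) J"
  shows "(\<Sum>s\<in>{..M} \<rightarrow>\<^sub>E {..<2 * N}. \<Prod>j\<in>J. obs_density (\<lambda>z. design_profile N k (phase M (2 * N) s z))
             (\<lambda>z. regression_profile b k (phase M (2 * N) s z)) (x j)) =
         of_nat (2 * N) ^ card ({..M} - (\<lambda>j. block M (2 * N) (snd (x j))) ` J) *
         (\<Prod>j\<in>J. indicator {0..1} (snd (x j)) * (of_nat N *
            (ennreal (std_normal_density (fst (x j) - b)) + ennreal (std_normal_density (fst (x j) + b)))))"
    (is "?lhs = ?C * ?rhs")
proof -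
  let ?K = "2 * N"
  let ?pos = "\<lambda>j t. (cell (M * ?K) (snd (x j)) mod ?K + t) mod ?K"
  let ?\<phi> = "\<lambda>j y. ennreal (std_normal_density (fst (x j) - y))"
  define F where "F j i = indicator {0..1} (snd (x j)) *
    (ennreal (design_profile N k i) * ?\<phi> j (regression_profile b k i))" for j i
  have shift: "(\<Sum>t<?K. F j (?pos j t)) = indicator {0..1} (snd (x j)) *
      (of_nat N * (?\<phi> j b + ?\<phi> j (- b)))" for j
  proof -
    have "(\<Sum>t<?K. F j (?pos j t)) = (\<Sum>t<?K. F j ((t + cell (M * ?K) (snd (x j)) mod ?K) mod ?K))"
      by (simp only: add.commute)
    also have "\<dots> = (\<Sum>i<?K. F j i)"
      using assms by (intro sum_cyclic_shift) simp
    also have "\<dots> = indicator {0..1} (snd (x j)) * (of_nat N * (?\<phi> j b + ?\<phi> j (- b)))"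
      unfolding F_def sum_distrib_left[symmetric]
      by (simp only: sum_profiles_independent_of_split[OF assms(1,2), where F = "?\<phi> j"])
    finally show ?thesis .
  qed
  have "?lhs = (\<Sum>s\<in>{..M} \<rightarrow>\<^sub>E {..<?K}. \<Prod>j\<in>J. F j (?pos j (s (block M ?K (snd (x j))))))"
    by (simp add: obs_density_def F_def phase_def mult.assoc)
  also have "\<dots> = ?C * (\<Prod>j\<in>J. \<Sum>t<?K. F j (?pos j t))"
    using inj by (subst sum_PiE_prod_at_distinct_points) (auto simp: block_def)
  finally show ?thesis
    by (simp add: shift)
qed

lemma design_profile_in_density_class:
  assumes "0 < k" "k < 2 * N" "M > 0"
    and bounds: "\<And>i. \<rho> \<le> design_profile N k i \<and> design_profile N k i \<le> \<rho>bar"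
  shows "(\<lambda>z. design_profile N k (phase M (2 * N) s z)) \<in> density_class \<rho> \<rho>bar"
proof -
  let ?f = "\<lambda>z. design_profile N k (phase M (2 * N) s z)"
  have int: "has_bochner_integral lborel (\<lambda>z. indicator {0..1} z * ?f z) 1"
    using has_bochner_integral_phase[of M "2 * N" 0 M "design_profile N k" s] assms
    by (simp add: sum_design_profile)
  have "(\<integral>\<^sup>+z\<in>{0..1}. ennreal (?f z) \<partial>lborel) = (\<integral>\<^sup>+z. ennreal (indicator {0..1} z * ?f z) \<partial>lborel)"
    by (intro nn_integral_cong) (simp add: indicator_def)
  also have "\<dots> = ennreal (\<integral>z. indicator {0..1} z * ?f z \<partial>lborel)"
    using int assms(2) by (intro nn_integral_eq_integral)
      (auto simp: has_bochner_integral_iff design_profile_def indicator_def)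
  also have "\<dots> = 1"
    using has_bochner_integral_integral_eq[OF int] by simp
  finally show ?thesis
    using bounds by (simp add: density_class_def measurable_restrict_space1)
qed

lemma regression_profile_in_regression_class:
  "(\<lambda>z. regression_profile b k (phase M K s z)) \<in> regression_class \<bar>b\<bar>"
  by (simp add: regression_class_def measurable_restrict_space1) (simp add: regression_profile_def)

text \<open>
  Since the number of blocks is a multiple of four, the interval from \<open>1/4\<close> to \<open>3/4\<close>
  consists of whole blocks.
\<close>

lemma integral_regression_profile:
  assumes "0 < n" "0 < N" "k \<le> 2 * N"
  shows "(LBINT z:{1/4..3/4}. regression_profile b k (phase (4 * n\<^sup>2) (2 * N) s z)) =
         b * (real k - real N) / (2 * real N)"
proof -
  have "has_bochner_integral lborel (\<lambda>z. indicator {real (n\<^sup>2) / real (4 * n\<^sup>2)..real (3 * n\<^sup>2) / real (4 * n\<^sup>2)} z *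
      regression_profile b k (phase (4 * n\<^sup>2) (2 * N) s z))
      ((real (3 * n\<^sup>2) - real (n\<^sup>2)) / real (4 * n\<^sup>2) * ((\<Sum>i<2 * N. regression_profile b k i) / real (2 * N)))"
    using assms by (intro has_bochner_integral_phase) auto
  moreover have "real (n\<^sup>2) / real (4 * n\<^sup>2) = 1/4" "real (3 * n\<^sup>2) / real (4 * n\<^sup>2) = 3/4"
      "(real (3 * n\<^sup>2) - real (n\<^sup>2)) / real (4 * n\<^sup>2) = 1/2"
    using assms by (simp_all add: field_simps)
  moreover have "1/2 * ((\<Sum>i<2 * N. regression_profile b k i) / real (2 * N)) =
      b * (real k - real N) / (2 * real N)"
    using sum_regression_profile[OF assms(3), of b] by simp
  ultimately have "has_bochner_integral lborel (\<lambda>z. indicator {1/4..3/4} z *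
      regression_profile b k (phase (4 * n\<^sup>2) (2 * N) s z)) (b * (real k - real N) / (2 * real N))"
    by (simp only:)
  then show ?thesis
    by (simp add: set_lebesgue_integral_def has_bochner_integral_integral_eq)
qed

text \<open>
  The two mixtures have \<open>N\<close> and \<open>N + 1\<close> plus cells per block. In the first one the
  design is uniform for all shifts, so that the probability of distinct blocks is easy to bound.
\<close>

lemma minimax_mse_bounded_below:
  assumes "0 < n" "2 \<le> N" and \<rho>: "\<rho> \<le> real N / real (N + 1)" "real N / real (N - 1) \<le> \<rho>bar"
    and "0 < b" and T: "estimator n T"
  shows "ennreal ((b / (2 * real N))\<^sup>2 / 8) \<le>
    (SUP f\<in>density_class \<rho> \<rho>bar. SUP h\<in>regression_class b. mse n f h T (LBINT x:{1/4..3/4}. h x))"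
    (is "_ \<le> ?R")
proof -
  define M where "M = 4 * n\<^sup>2"
  define f where "f k s = (\<lambda>z. design_profile N k (phase M (2 * N) s z))" for k s
  define h where "h k s = (\<lambda>z. regression_profile b k (phase M (2 * N) s z))" for k s
  define w where "w k s x = (\<Prod>j\<in>{1..n}. obs_density (f k s) (h k s) (x j))" for k s x
  define \<theta> where "\<theta> k = b * (real k - real N) / (2 * real N)" for k :: nat
  have [measurable]: "f k s \<in> borel_measurable borel" "h k s \<in> borel_measurable borel" for k s
    unfolding f_def h_def by measurable
  have w_measurable: "w k s \<in> borel_measurable (\<Pi>\<^sub>M j\<in>{1..n}. obs_space)" for k s
    unfolding w_def by measurable
  have "M > 0" using assms(1) by (simp add: M_def)
  have T': "T \<in> borel_measurable (\<Pi>\<^sub>M j\<in>{1..n}. obs_space)"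
  proof -
    have "sets (\<Pi>\<^sub>M j\<in>{1..n}. borel \<Otimes>\<^sub>M borel :: (real \<times> real) measure) = sets (\<Pi>\<^sub>M j\<in>{1..n}. obs_space)"
      by (intro sets_PiM_cong sets_pair_measure_cong) auto
    then show ?thesis
      using T unfolding estimator_def by (subst (asm) measurable_cong_sets) auto
  qed
  \<comment> \<open>The levels of the density are \<open>1\<close> for \<open>k = N\<close>, and \<open>N / (N + 1)\<close> and
    \<open>N / (N - 1)\<close> for \<open>k = N + 1\<close>.\<close>
  have bounds: "\<rho> \<le> design_profile N k i \<and> design_profile N k i \<le> \<rho>bar" if "k = N \<or> k = N + 1" for k i
  proof -
    have le: "real N / real (N + 1) \<le> 1" "1 \<le> real N / real (N - 1)"
      using assms(2) by (simp_all add: field_simps of_nat_diff)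
    have two_N: "2 * real N - real (N + 1) = real (N - 1)" "2 * real N - real N = real N"
      using assms(2) by (simp_all add: of_nat_diff)
    have "design_profile N k i \<in> {1, real N / real (N + 1), real N / real (N - 1)}"
      using that
    proof
      assume "k = N"
      then show ?thesis
        using assms(2) by (simp add: design_profile_def two_N)
    next
      assume k: "k = N + 1"
      show ?thesis
        unfolding design_profile_def k two_N by simp
    qed
    moreover have "\<rho> \<le> y \<and> y \<le> \<rho>bar" if "y \<in> {1, l, u}" "l \<le> 1" "1 \<le> u" "\<rho> \<le> l" "u \<le> \<rho>bar" for y l u
      using that by auto
    ultimately show ?thesis
      using le \<rho> by blast
  qed
  have risk: "(\<integral>\<^sup>+x. w k s x * ennreal (\<bar>T x - \<theta> k\<bar>\<^sup>2) \<partial>(\<Pi>\<^sub>M j\<in>{1..n}. obs_space)) \<le> ?R"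
    if k: "k = N \<or> k = N + 1" for k s
  proof -
    have f: "f k s \<in> density_class \<rho> \<rho>bar"
      unfolding f_def using k assms(2) \<open>M > 0\<close> bounds[OF k]
      by (intro design_profile_in_density_class) auto
    have h: "h k s \<in> regression_class b"
      using regression_profile_in_regression_class[of b k M "2 * N" s] assms by (simp add: h_def)
    have "(LBINT z:{1/4..3/4}. h k s z) = \<theta> k"
      unfolding h_def \<theta>_def M_def using k assms(1,2) by (intro integral_regression_profile) auto
    then have "(\<integral>\<^sup>+x. w k s x * ennreal (\<bar>T x - \<theta> k\<bar>\<^sup>2) \<partial>(\<Pi>\<^sub>M j\<in>{1..n}. obs_space)) =
        mse n (f k s) (h k s) T (LBINT z:{1/4..3/4}. h k s z)"
      unfolding w_def using f h T by (subst mse_eq_nn_integral_density) auto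
    also have "\<dots> \<le> ?R"
      by (rule SUP_upper2[OF f], rule SUP_upper[OF h])
    finally show ?thesis .
  qed
  have "ennreal ((\<theta> N - \<theta> (N + 1))\<^sup>2 / 8) \<le> ?R"
  proof (rule two_mixtures_lower_bound[where S = "{..M} \<rightarrow>\<^sub>E {..<2 * N}" and G = "distinct_blocks n M (2 * N)"
        and M = "\<Pi>\<^sub>M j\<in>{1..n}. obs_space" and w\<^sub>1 = "w N" and w\<^sub>2 = "w (N + 1)" and T = T])
    show "finite ({..M} \<rightarrow>\<^sub>E {..<2 * N})"
      by (intro finite_PiE) auto
    show "{..M} \<rightarrow>\<^sub>E {..<2 * N} \<noteq> {}"
      using assms(2) by (auto simp: PiE_eq_empty_iff lessThan_empty_iff bot_nat_def)
    show "(\<Sum>s\<in>{..M} \<rightarrow>\<^sub>E {..<2 * N}. w N s x) = (\<Sum>s\<in>{..M} \<rightarrow>\<^sub>E {..<2 * N}. w (N + 1) s x)"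
      if "x \<in> distinct_blocks n M (2 * N)" for x
      using that assms(2) unfolding w_def f_def h_def distinct_blocks_def
      by (simp add: sum_obs_density_over_shifts)
    show "ennreal (1 / 2) \<le> (\<integral>\<^sup>+x. w N s x * indicator (distinct_blocks n M (2 * N)) x \<partial>(\<Pi>\<^sub>M j\<in>{1..n}. obs_space))" for s
    proof -
      have "f N s = (\<lambda>_. 1)"
        using assms(2) by (simp add: f_def design_profile_def fun_eq_iff)
      then show ?thesis
        unfolding w_def using assms(1,2)
        by (simp only:) (intro distinct_blocks_likely; simp add: M_def)
    qed
  qed (rule T' w_measurable sets_distinct_blocks risk[OF disjI1[OF refl]] risk[OF disjI2[OF refl]])+
  moreover have "\<theta> N - \<theta> (N + 1) = - (b / (2 * real N))"
    by (simp add: \<theta>_def)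
  ultimately show ?thesis
    by simp
qed

theorem theorem3:
  fixes \<rho> \<rho>bar \<rho>til :: real
    and H :: "nat \<Rightarrow> (nat \<Rightarrow> real \<times> real) \<Rightarrow> real"
  assumes "\<rho>bar > 1" and "0 < \<rho>" and "\<rho> < 1" and "\<rho>til > 0"
    and "\<And>n. estimator n (H n)"
  shows "liminf (\<lambda>n. ennreal (real n powr (1/2)) *
           (SUP f\<in>density_class \<rho> \<rho>bar. SUP h\<in>regression_class \<rho>til.
              mse n f h (H n) (LBINT x:{1/4..3/4}. h x))) > 0"
proof -
  have "(\<lambda>N. real N / (real N + 1)) \<longlonglongrightarrow> 1" "(\<lambda>N. real N / (real N - 1)) \<longlonglongrightarrow> 1"
    by real_asymp+
  then have "\<forall>\<^sub>F N in sequentially. \<rho> < real N / (real N + 1)"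
      "\<forall>\<^sub>F N in sequentially. real N / (real N - 1) < \<rho>bar"
    using order_tendstoD(1)[OF _ assms(3)] order_tendstoD(2)[OF _ assms(1)] by blast+
  moreover have "\<forall>\<^sub>F N in sequentially. (2::nat) \<le> N"
    by (rule eventually_ge_at_top)
  ultimately have "\<forall>\<^sub>F N in sequentially. \<rho> < real N / (real N + 1) \<and> real N / (real N - 1) < \<rho>bar \<and> 2 \<le> N"
    by (intro eventually_conj)
  then obtain N :: nat where N: "\<rho> < real N / (real N + 1)" "real N / (real N - 1) < \<rho>bar" "2 \<le> N"
    using eventually_happens'[OF sequentially_bot] by blast
  have \<rho>: "\<rho> \<le> real N / real (N + 1)" "real N / real (N - 1) \<le> \<rho>bar"
    using N by (simp_all add: of_nat_diff add.commute)
  \<comment> \<open>One eighth of the squared distance between the integrals of the two regression functions.\<close>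
  define c where "c = (\<rho>til / (2 * real N))\<^sup>2 / 8"
  have "c > 0"
    using assms N by (simp add: c_def)
  let ?R = "\<lambda>n. SUP f\<in>density_class \<rho> \<rho>bar. SUP h\<in>regression_class \<rho>til.
              mse n f h (H n) (LBINT x:{1/4..3/4}. h x)"
  have "\<forall>\<^sub>F n in sequentially. ennreal c \<le> ennreal (real n powr (1/2)) * ?R n"
    using eventually_gt_at_top[of 0]
  proof eventually_elim
    case (elim n)
    have "1 \<le> real n powr (1/2)"
      using elim by (intro ge_one_powr_ge_zero) auto
    then have "1 \<le> ennreal (real n powr (1/2))"
      using ennreal_leI by fastforce
    moreover have "ennreal c \<le> ?R n"
      unfolding c_def by (rule minimax_mse_bounded_below[OF elim N(3) \<rho> assms(4,5)])
    ultimately have "1 * ennreal c \<le> ennreal (real n powr (1/2)) * ?R n"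
      by (rule mult_mono) auto
    then show ?case by simp
  qed
  then have "ennreal c \<le> liminf (\<lambda>n. ennreal (real n powr (1/2)) * ?R n)"
    by (rule Liminf_bounded)
  moreover have "0 < ennreal c"
    using \<open>c > 0\<close> by simp
  ultimately show ?thesis
    by (rule order_less_le_trans[rotated])
qed

end
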